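(* Let $n\ge 2$ be an integer and let $X$ be a random variable with values in $\{0,1,2,\dots\}$ and probability generating function $P$. Then $X$ is distributed as the sum of $n$ i.i.d. random variables whose common distribution is of the same D-type as that of $X$ (i.e. has probability generating function $s\mapsto P(1-b+bs)$ for some $0<b<1$) if and only if $P$ is $\mathrm{DSS}(n,b,\alpha)$ for some $0<b<1$ and $0<\alpha\le 1$.
   Context: A probability generating function $P$ is discrete semi stable, $\mathrm{DSS}(a,b,\alpha)$, where $0<b<1<a$ and $0<\alpha\le1$ satisfy $ab^\alpha=1$, if $P(s)=\exp\{-\psi(1-s)\}$ where $\psi$ is a continuous function with $\psi(0)=0$ such that $\psi(1-s)=a\,\psi[b(1-s)]$ for all $0<s<1$. Two probability generating functions $P_1,P_2$ are of the same D-type if $P_1(1-s)=P_2(1-cs)$ for all $0<s<1$ and some $0<c<1$, equivalently $P_1(u)=P_2(1-c+cu)$ for $0<u<1$; here $P_1$ is the generating function of the components and $P_2=P$ that of the sum. *)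

theory Defs
  imports "HOL-Probability.Probability"
begin

text \<open>The generating function \<open>s \<mapsto> E(s ^ X)\<close> of an \<open>\<nat>\<close>-valued random variable. It is only ever
  compared with other functions on the unit interval; the convention \<open>0 ^ 0 = 1\<close> makes its value
  at \<open>0\<close> the probability of \<open>X = 0\<close>.\<close>
definition pgf :: "'a measure \<Rightarrow> ('a \<Rightarrow> nat) \<Rightarrow> real \<Rightarrow> real" where
  "pgf M X s = (\<integral>\<omega>. s ^ X \<omega> \<partial>M)"

definition is_pgf :: "(real \<Rightarrow> real) \<Rightarrow> bool" where
  "is_pgf P \<longleftrightarrow> (\<exists>p :: nat pmf. \<forall>s\<in>{0..1}. P s = pgf (measure_pmf p) (\<lambda>k. k) s)"

text \<open>The equation \<open>P s = exp (- \<psi> (1 - s))\<close> is taken on the whole of \<open>[0, 1]\<close>, so \<open>\<psi>\<close> matters only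
  on \<open>[0, 1]\<close>. By continuity it is equivalent to ask for the equation on the open interval.\<close>
definition DSS :: "real \<Rightarrow> real \<Rightarrow> real \<Rightarrow> (real \<Rightarrow> real) \<Rightarrow> bool" where
  "DSS a b \<alpha> P \<longleftrightarrow>
     is_pgf P \<and> 0 < b \<and> b < 1 \<and> 1 < a \<and> 0 < \<alpha> \<and> \<alpha> \<le> 1 \<and> a * b powr \<alpha> = 1 \<and>
     (\<exists>\<psi> :: real \<Rightarrow> real. continuous_on {0..1} \<psi> \<and> \<psi> 0 = 0 \<and>
        (\<forall>s\<in>{0..1}. P s = exp (- \<psi> (1 - s))) \<and>
        (\<forall>s. 0 < s \<and> s < 1 \<longrightarrow> \<psi> (1 - s) = a * \<psi> (b * (1 - s))))"

text \<open>Not symmetric: \<open>P1\<close> is obtained from \<open>P2\<close> by thinning with retention probability \<open>c\<close>.\<close>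
definition same_D_type :: "(real \<Rightarrow> real) \<Rightarrow> (real \<Rightarrow> real) \<Rightarrow> bool" where
  "same_D_type P1 P2 \<longleftrightarrow>
     (\<exists>c. 0 < c \<and> c < 1 \<and> (\<forall>s. 0 < s \<and> s < 1 \<longrightarrow> P1 (1 - s) = P2 (1 - c * s)))"

definition iid :: "'a measure \<Rightarrow> nat \<Rightarrow> (nat \<Rightarrow> 'a \<Rightarrow> nat) \<Rightarrow> bool" where
  "iid N n Y \<longleftrightarrow>
     prob_space.indep_vars N (\<lambda>_. count_space UNIV) Y {..<n} \<and>
     (\<forall>i<n. \<forall>j<n. distr N (count_space UNIV) (Y i) = distr N (count_space UNIV) (Y j))"

text \<open>\<open>X\<close> has the law of a sum of \<open>n\<close> i.i.d. variables of the same D-type. The summands may live on a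
  probability space other than that of \<open>X\<close>. Its sample type is fixed to be \<open>nat \<Rightarrow> nat\<close>; this is no
  restriction, because the condition depends only on the joint law of the \<open>n\<close> summands.\<close>
definition iid_sum_same_D_type :: "nat \<Rightarrow> 'a measure \<Rightarrow> ('a \<Rightarrow> nat) \<Rightarrow> bool" where
  "iid_sum_same_D_type n M X \<longleftrightarrow>
     (\<exists>(N :: (nat \<Rightarrow> nat) measure) Y. prob_space N \<and> iid N n Y \<and>
        (\<forall>i<n. same_D_type (pgf N (Y i)) (pgf M X)) \<and>
        distr M (count_space UNIV) X = distr N (count_space UNIV) (\<lambda>\<omega>. \<Sum>i<n. Y i \<omega>))"

end

theory Submission
  imports Defs "HOL-Complex_Analysis.Cauchy_Integral_Formula"
begin

text \<open>Write \<open>P = exp (- \<psi> (1 - \<cdot>))\<close>. A decomposition of \<open>X\<close> into \<open>n\<close> i.i.d. summands with generating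
  function \<open>u \<mapsto> P (1 - b + b u)\<close> says \<open>P (1 - s) = P (1 - b s) ^ n\<close>, that is \<open>\<psi> s = n \<psi> (b s)\<close>, and
  \<open>n b powr \<alpha> = 1\<close> determines \<open>\<alpha> > 0\<close>. Since \<open>\<psi> s \<ge> 1 - P (1 - s) \<ge> s (1 - P 0)\<close>, iterating gives
  \<open>\<psi> 1 = n ^ k \<psi> (b ^ k) \<ge> (n b) ^ k (1 - P 0)\<close> for all \<open>k\<close>; hence \<open>n b \<le> 1\<close>, that is \<open>\<alpha> \<le> 1\<close>, unless
  \<open>X = 0\<close> almost surely, in which case \<open>b\<close> may be replaced by \<open>1 / n\<close>. Conversely, under DSS the
  binomial thinning of the law of \<open>X\<close> with retention probability \<open>b\<close> has generating function
  \<open>P (1 - b + b u)\<close>, whose \<open>n\<close>-th power is \<open>P\<close>, and generating functions determine laws.\<close>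

section \<open>Probability generating functions\<close>

context prob_space
begin

lemma integrable_pgf:
  assumes [measurable]: "X \<in> measurable M (count_space UNIV)" and s: "s \<in> {0..1::real}"
  shows "integrable M (\<lambda>\<omega>. s ^ X \<omega>)"
  by (rule integrable_const_bound[where B = 1]) (use s in \<open>auto simp: power_le_one\<close>)

lemma pgf_1: "pgf M X 1 = 1"
  by (simp add: pgf_def prob_space)

lemma pgf_le_1:
  assumes "X \<in> measurable M (count_space UNIV)" "s \<in> {0..1}"
  shows "pgf M X s \<le> 1"
proof -
  have "pgf M X s \<le> (\<integral>\<omega>. 1 \<partial>M)"
    unfolding pgf_def by (rule integral_mono) (use assms integrable_pgf in \<open>auto simp: power_le_one\<close>)
  then show ?thesis by (simp add: prob_space)
qed

lemma pgf_nonneg: "s \<in> {0..1} \<Longrightarrow> 0 \<le> pgf M X s"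
  unfolding pgf_def by (rule integral_nonneg_AE) auto

text \<open>A nonnegative integrand with integral zero vanishes almost surely, but
  \<open>s ^ X\<close> is positive for \<open>s > 0\<close>. At \<open>s = 0\<close> positivity can
  fail.\<close>

lemma pgf_pos:
  assumes [measurable]: "X \<in> measurable M (count_space UNIV)" and s: "0 < s" "s \<le> 1"
  shows "0 < pgf M X s"
proof -
  have int: "integrable M (\<lambda>\<omega>. s ^ X \<omega>)"
    using s by (intro integrable_pgf) auto
  have "pgf M X s \<noteq> 0"
  proof
    assume "pgf M X s = 0"
    then have "AE \<omega> in M. s ^ X \<omega> = 0"
      using integral_nonneg_eq_0_iff_AE[OF int] s by (auto simp: pgf_def)
    then have "AE \<omega> in M. False"
      by eventually_elim (use s in simp)
    then show False by simp
  qed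
  with pgf_nonneg[of s X] s show ?thesis by simp
qed

lemma continuous_on_pgf:
  assumes [measurable]: "X \<in> measurable M (count_space UNIV)"
  shows "continuous_on {0..1} (pgf M X)"
proof (rule continuous_on_sequentiallyI)
  fix u :: "nat \<Rightarrow> real" and a
  assume u: "\<forall>n. u n \<in> {0..1}" and a: "a \<in> {0..1}" and lim: "u \<longlonglongrightarrow> a"
  show "(\<lambda>n. pgf M X (u n)) \<longlonglongrightarrow> pgf M X a"
    unfolding pgf_def
  proof (rule integral_dominated_convergence[where w = "\<lambda>_. 1"])
    show "AE \<omega> in M. (\<lambda>i. u i ^ X \<omega>) \<longlonglongrightarrow> a ^ X \<omega>"
      using lim by (auto intro: tendsto_power)
    show "AE \<omega> in M. norm (u i ^ X \<omega>) \<le> 1" for i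
      using u by (auto simp: power_le_one)
  qed auto
qed

text \<open>Convexity, applied pointwise: on [0, 1] each \<open>s ^ k\<close> lies below its chord,
  which is constant for \<open>k = 0\<close> and equals \<open>s\<close> for \<open>k > 0\<close>.
  This bounds \<open>1 - P (1 - s)\<close> below by a linear function of \<open>s\<close>.\<close>

lemma pgf_le_chord:
  assumes [measurable]: "X \<in> measurable M (count_space UNIV)" and s: "s \<in> {0..1}"
  shows "pgf M X s \<le> s + (1 - s) * pgf M X 0"
proof -
  have "pgf M X s \<le> (\<integral>\<omega>. s + (1 - s) * 0 ^ X \<omega> \<partial>M)"
    unfolding pgf_def
  proof (rule integral_mono)
    fix \<omega>
    show "s ^ X \<omega> \<le> s + (1 - s) * 0 ^ X \<omega>"
      using s by (cases "X \<omega>") (auto simp: power_le_one mult_left_le)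
  qed (use s integrable_pgf integrable_pgf[of X 0] in auto)
  also have "\<dots> = s + (1 - s) * pgf M X 0"
    using integrable_pgf[of X 0] by (simp add: pgf_def prob_space)
  finally show ?thesis .
qed

lemma pgf_distr:
  assumes [measurable]: "X \<in> measurable M (count_space UNIV)"
  shows "pgf (distr M (count_space UNIV) X) (\<lambda>k. k) s = pgf M X s"
  by (simp add: pgf_def integral_distr)

lemma pgf_sum_indep:
  assumes "finite I" and indep: "indep_vars (\<lambda>_. count_space UNIV) Y I" and s: "s \<in> {0..1}"
  shows "pgf M (\<lambda>\<omega>. \<Sum>i\<in>I. Y i \<omega>) s = (\<Prod>i\<in>I. pgf M (Y i) s)"
proof -
  have "indep_vars (\<lambda>_. borel) (\<lambda>i \<omega>. s ^ Y i \<omega>) I"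
    by (rule indep_vars_compose2[OF indep]) auto
  moreover have "integrable M (\<lambda>\<omega>. s ^ Y i \<omega>)" if "i \<in> I" for i
    using indep that s by (intro integrable_pgf) (auto simp: indep_vars_def)
  ultimately show ?thesis
    using \<open>finite I\<close> by (simp add: pgf_def power_sum indep_vars_lebesgue_integral)
qed

text \<open>A law on a countable space charges only its atoms, so it is a pmf. Uniqueness and
  thinning can thus be treated for pmfs.\<close>

lemma distr_eq_measure_pmf:
  fixes X :: "'a \<Rightarrow> nat"
  assumes [measurable]: "X \<in> measurable M (count_space UNIV)"
  obtains p where "distr M (count_space UNIV) X = measure_pmf p"
proof -
  interpret D: prob_space "distr M (count_space UNIV) X"
    by (rule prob_space_distr) fact
  have "AE x in distr M (count_space UNIV) X. measure (distr M (count_space UNIV) X) {x} \<noteq> 0"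
    by (subst D.AE_support_countable) (auto intro: exI[of _ UNIV])
  then have "measure_pmf (Abs_pmf (distr M (count_space UNIV) X)) = distr M (count_space UNIV) X"
    by (intro Abs_pmf_inverse) (auto intro: D.prob_space_axioms)
  then show thesis
    using that by metis
qed

end

section \<open>Power series and uniqueness of the law\<close>

lemma pgf_pmf_sums:
  assumes "\<bar>s\<bar> \<le> 1"
  shows "(\<lambda>k. pmf p k * s ^ k) sums pgf (measure_pmf p) (\<lambda>k. k) s"
proof -
  have int: "integrable (measure_pmf p) (\<lambda>k. s ^ k)"
    by (rule measure_pmf.integrable_const_bound[where B = 1])
      (use assms in \<open>auto simp: power_abs power_le_one\<close>)
  then have "integrable (count_space UNIV) (\<lambda>k. pmf p k * s ^ k)"
    by (simp add: measure_pmf_eq_density integrable_density)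
  from sums_integral_count_space_nat[OF this] show ?thesis
    by (simp add: pgf_def measure_pmf_eq_density integral_density)
qed

text \<open>The difference of the two power series vanishes on [0, 1], so 0 is not an isolated zero
  and all coefficients are 0. The series must also converge for negative \<open>s\<close>, to cover
  a full neighbourhood of 0.\<close>

lemma pmf_eq_if_pgf_eq:
  assumes eq: "\<And>s. s \<in> {0..1} \<Longrightarrow> pgf (measure_pmf p) (\<lambda>k. k) s = pgf (measure_pmf q) (\<lambda>k. k) s"
  shows "p = q"
proof (rule pmf_eqI)
  fix k
  define d where "d = (\<lambda>k. pmf p k - pmf q k)"
  define f where "f = (\<lambda>s. pgf (measure_pmf p) (\<lambda>k. k) s - pgf (measure_pmf q) (\<lambda>k. k) s)"
  have sums: "(\<lambda>k. d k * s ^ k) sums f s" if "\<bar>s\<bar> \<le> 1" for s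
    using sums_diff[OF pgf_pmf_sums[OF that, of p] pgf_pmf_sums[OF that, of q]]
    by (simp add: d_def f_def left_diff_distrib)
  have f0: "f s = 0" if "s \<in> {0..1}" for s
    using eq[OF that] by (simp add: f_def)
  have "d k = 0"
  \<comment> \<open>Isolation of the zero needs a nonzero coefficient of positive index, so the
    constant term is read off at 0.\<close>
  proof (cases "k = 0")
    case True
    have "f 0 = d 0"
      using sums_unique2[OF sums[of 0] powser_sums_zero[of d]] by simp
    then show ?thesis using f0[of 0] True by simp
  next
    case False
    show ?thesis
    proof (rule ccontr)
      assume "d k \<noteq> 0"
      obtain r where "0 < r" and nz: "\<And>z. z \<in> cball 0 r - {0} \<Longrightarrow> f z \<noteq> 0"
      proof (rule powser_0_nonzero[of 1 0 d f k])
        show "(\<lambda>n. d n * (x - 0) ^ n) sums f x" if "norm (x - 0) < 1" for x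
          using sums that by simp
      qed (use f0[of 0] False \<open>d k \<noteq> 0\<close> in auto)
      have "min r 1 \<in> cball 0 r - {0}"
        using \<open>0 < r\<close> by auto
      from nz[OF this] f0[of "min r 1"] \<open>0 < r\<close> show False by auto
    qed
  qed
  then show "pmf p k = pmf q k" by (simp add: d_def)
qed

lemma distr_eq_if_pgf_eq:
  fixes X :: "'a \<Rightarrow> nat" and Y :: "'b \<Rightarrow> nat"
  assumes "prob_space M" "X \<in> measurable M (count_space UNIV)"
    and "prob_space N" "Y \<in> measurable N (count_space UNIV)"
    and eq: "\<And>s. s \<in> {0..1} \<Longrightarrow> pgf M X s = pgf N Y s"
  shows "distr M (count_space UNIV) X = distr N (count_space UNIV) Y"
proof -
  obtain p where p: "distr M (count_space UNIV) X = measure_pmf p"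
    using prob_space.distr_eq_measure_pmf assms by blast
  obtain q where q: "distr N (count_space UNIV) Y = measure_pmf q"
    using prob_space.distr_eq_measure_pmf assms by blast
  have "p = q"
    using eq prob_space.pgf_distr[OF assms(1,2)] prob_space.pgf_distr[OF assms(3,4)]
    by (intro pmf_eq_if_pgf_eq) (simp add: p q)
  then show ?thesis by (simp add: p q)
qed

section \<open>Binomial thinning\<close>

lemma pgf_binomial:
  assumes "b \<in> {0..1}"
  shows "pgf (measure_pmf (binomial_pmf k b)) (\<lambda>j. j) s = (1 - b + b * s) ^ k"
proof -
  have "(1 - b + b * s) ^ k = (b * s + (1 - b)) ^ k"
    by (simp add: add.commute)
  also have "\<dots> = (\<Sum>j\<le>k. real (k choose j) * (b * s) ^ j * (1 - b) ^ (k - j))"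
    by (rule binomial_ring)
  finally show ?thesis
    using assms by (simp add: pgf_def expectation_binomial_pmf' power_mult_distrib mult_ac)
qed

text \<open>Given the value \<open>k\<close>, the thinned variable is binomial with generating
  function \<open>(1 - b + b * s) ^ k\<close>; averaging over \<open>p\<close> evaluates the
  original generating function at \<open>1 - b + b * s\<close>.\<close>

lemma pgf_thinning:
  assumes b: "b \<in> {0..1}" and s: "s \<in> {0..1}"
  shows "pgf (measure_pmf (bind_pmf p (\<lambda>k. binomial_pmf k b))) (\<lambda>j. j) s
       = pgf (measure_pmf p) (\<lambda>k. k) (1 - b + b * s)"
proof -
  have u: "1 - b + b * s \<in> {0..1}"
    using b s by (auto simp: mult_left_le)
  \<comment> \<open>For nonnegative integrals, integration against \<open>bind_pmf\<close> is
    iterated integration without integrability conditions.\<close>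
  have nn: "(\<integral>\<^sup>+j. ennreal (t ^ j) \<partial>measure_pmf q) = ennreal (pgf (measure_pmf q) (\<lambda>j. j) t)"
    if "t \<in> {0..1}" for q and t :: real
    unfolding pgf_def using that measure_pmf.integrable_pgf[of "\<lambda>j. j" q t]
    by (intro nn_integral_eq_integral) auto
  have "ennreal (pgf (measure_pmf (bind_pmf p (\<lambda>k. binomial_pmf k b))) (\<lambda>j. j) s)
      = (\<integral>\<^sup>+k. \<integral>\<^sup>+j. ennreal (s ^ j) \<partial>measure_pmf (binomial_pmf k b) \<partial>measure_pmf p)"
    by (subst nn[OF s, symmetric]) simp
  also have "\<dots> = (\<integral>\<^sup>+k. ennreal ((1 - b + b * s) ^ k) \<partial>measure_pmf p)"
    by (simp only: nn[OF s] pgf_binomial[OF b])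
  also have "\<dots> = ennreal (pgf (measure_pmf p) (\<lambda>k. k) (1 - b + b * s))"
    by (rule nn[OF u])
  finally have "ennreal (pgf (measure_pmf (bind_pmf p (\<lambda>k. binomial_pmf k b))) (\<lambda>j. j) s)
      = ennreal (pgf (measure_pmf p) (\<lambda>k. k) (1 - b + b * s))" .
  then show ?thesis
    using s u by (simp add: measure_pmf.pgf_nonneg)
qed

section \<open>The functional equation\<close>

lemma eq_on_closed_unit_interval:
  fixes f g :: "real \<Rightarrow> real"
  assumes "continuous_on {0..1} f" "continuous_on {0..1} g"
    and "\<And>s. 0 < s \<Longrightarrow> s < 1 \<Longrightarrow> f s = g s" and "s \<in> {0..1}"
  shows "f s = g s"
proof -
  have "f s - g s = 0"
    by (rule continuous_constant_on_closure[of "{0<..<1}"])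
      (use assms in \<open>auto intro: continuous_on_diff\<close>)
  then show ?thesis by simp
qed

context prob_space
begin

lemma continuous_on_pgf_affine:
  assumes "X \<in> measurable M (count_space UNIV)" "c \<in> {0..1}"
  shows "continuous_on {0..1} (\<lambda>s. pgf M X (1 - c * s))"
  by (rule continuous_on_compose2[OF continuous_on_pgf[OF assms(1)]])
    (use assms in \<open>auto intro!: continuous_intros mult_le_one\<close>)

text \<open>The exponent is forced by \<open>a * b powr \<alpha> = 1\<close>, and
  \<open>a * b \<le> 1\<close> is what makes it at most 1. The witness for \<open>\<psi>\<close> is
  \<open>- ln (P (1 - s))\<close>, hence positivity also at 0.\<close>

lemma DSS_pgfI:
  assumes X: "X \<in> measurable M (count_space UNIV)"
    and b: "0 < b" "b < 1" and a: "1 < a" "a * b \<le> 1"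
    and pos: "\<And>s. s \<in> {0..1} \<Longrightarrow> 0 < pgf M X s"
    and eq: "\<And>s. 0 < s \<Longrightarrow> s < 1 \<Longrightarrow> ln (pgf M X (1 - s)) = a * ln (pgf M X (1 - b * s))"
  shows "\<exists>\<alpha>. DSS a b \<alpha> (pgf M X)"
proof -
  define \<alpha> where "\<alpha> = ln a / - ln b"
  have "ln b < 0" "0 < ln a" using a b by auto
  moreover have "ln a + ln b \<le> 0"
  proof -
    have "ln a + ln b = ln (a * b)"
      using a b by (simp add: ln_mult)
    then show ?thesis using a b by simp
  qed
  ultimately have \<alpha>: "0 < \<alpha>" "\<alpha> \<le> 1"
    by (auto simp: \<alpha>_def field_simps)
  have "b powr \<alpha> = exp (- ln a)"
    using b \<open>ln b < 0\<close> by (simp add: powr_def \<alpha>_def)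
  then have ab: "a * b powr \<alpha> = 1"
    using a by (simp add: exp_minus)
  have "is_pgf (pgf M X)"
  proof -
    obtain p where "distr M (count_space UNIV) X = measure_pmf p"
      using distr_eq_measure_pmf[OF X] by blast
    then show ?thesis
      unfolding is_pgf_def using pgf_distr[OF X] by metis
  qed
  moreover have "continuous_on {0..1} (\<lambda>s. - ln (pgf M X (1 - s)))"
  proof (intro continuous_intros ballI)
    show "continuous_on {0..1} (\<lambda>s. pgf M X (1 - s))"
      using continuous_on_pgf_affine[OF X, of 1] by simp
    show "pgf M X (1 - s) \<noteq> 0" if "s \<in> {0..1}" for s
      using pos[of "1 - s"] that by auto
  qed
  moreover have "pgf M X s = exp (- (- ln (pgf M X (1 - (1 - s)))))" if "s \<in> {0..1}" for s
    using pos[OF that] by simp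
  moreover have "- ln (pgf M X (1 - (1 - s))) = a * - ln (pgf M X (1 - b * (1 - s)))"
    if "0 < s" "s < 1" for s
    using eq[of "1 - s"] that by simp
  ultimately have "DSS a b \<alpha> (pgf M X)"
    unfolding DSS_def using a b \<alpha> ab
    by (intro conjI exI[of _ "\<lambda>s. - ln (pgf M X (1 - s))"]) (simp_all add: pgf_1)
  then show ?thesis ..
qed

lemma DSS_if_decomposable:
  assumes X: "X \<in> measurable M (count_space UNIV)" and n: "n \<ge> 2"
    and c: "0 < c" "c < 1"
    and eq: "\<And>s. s \<in> {0..1} \<Longrightarrow> pgf M X (1 - s) = pgf M X (1 - c * s) ^ n"
  shows "\<exists>b \<alpha>. DSS (real n) b \<alpha> (pgf M X)"
proof -
  let ?P = "pgf M X"
  have pos: "0 < ?P s" if "s \<in> {0..1}" for s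
  proof (cases "s = 0")
    case True
    \<comment> \<open>The endpoint \<open>s = 1\<close> of the equation excludes
      \<open>P 0 = 0\<close>, so the logarithm is defined on all of [0, 1].\<close>
    have "?P 0 = ?P (1 - c) ^ n"
      using eq[of 1] by simp
    then show ?thesis
      using pgf_pos[OF X, of "1 - c"] c True by simp
  qed (use that pgf_pos[OF X] in auto)
  define \<psi> where "\<psi> = (\<lambda>s. - ln (?P (1 - s)))"
  have \<psi>_eq: "\<psi> s = real n * \<psi> (c * s)" if "s \<in> {0..1}" for s
  proof -
    have "1 - c * s \<in> {0..1}"
      using c that by (auto intro: mult_le_one)
    from pos[OF this] show ?thesis
      unfolding \<psi>_def eq[OF that] by (simp add: ln_realpow)
  qed
  show ?thesis
  proof (cases "real n * c \<le> 1")
    case True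
    have "\<exists>\<alpha>. DSS (real n) c \<alpha> ?P"
      by (rule DSS_pgfI[OF X c _ True pos]) (use n \<psi>_eq in \<open>auto simp: \<psi>_def\<close>)
    then show ?thesis by blast
  next
    case False
    have iter: "\<psi> 1 = real n ^ k * \<psi> (c ^ k)" for k
    proof (induction k)
      case (Suc k)
      have "c ^ k \<in> {0..1}"
        using c by (auto intro: power_le_one)
      with Suc \<psi>_eq show ?case by (simp add: mult_ac)
    qed simp
    have lower: "s * (1 - ?P 0) \<le> \<psi> s" if "s \<in> {0..1}" for s
    proof -
      \<comment> \<open>The logarithm lies below its tangent at 1; the chord bound then makes the
        estimate linear in \<open>s\<close>.\<close>
      have "ln (?P (1 - s)) \<le> ?P (1 - s) - 1"
        using that by (intro ln_le_minus_one pos) auto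
      also have "\<dots> \<le> - (s * (1 - ?P 0))"
        using pgf_le_chord[OF X, of "1 - s"] that by (simp add: algebra_simps)
      finally show ?thesis by (simp add: \<psi>_def)
    qed
    have bound: "(real n * c) ^ k * (1 - ?P 0) \<le> \<psi> 1" for k
    proof -
      have "real n ^ k * (c ^ k * (1 - ?P 0)) \<le> real n ^ k * \<psi> (c ^ k)"
        using c by (intro mult_left_mono lower) (auto intro: power_le_one)
      then show ?thesis by (simp add: iter[of k] power_mult_distrib mult_ac)
    qed
    have P0: "?P 0 = 1"
    proof (rule ccontr)
      assume "?P 0 \<noteq> 1"
      with pgf_le_1[OF X, of 0] have "0 < 1 - ?P 0" by simp
      obtain k where "\<psi> 1 / (1 - ?P 0) < (real n * c) ^ k"
        using real_arch_pow[of "real n * c"] False by auto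
      with \<open>0 < 1 - ?P 0\<close> have "\<psi> 1 < (real n * c) ^ k * (1 - ?P 0)"
        by (simp add: pos_divide_less_eq)
      with bound[of k] show False by simp
    qed
    have P1: "?P s = 1" if s: "s \<in> {0..1}" for s
    proof -
      \<comment> \<open>This nonnegative function is the indicator of \<open>X > 0\<close>, and its
        integral is \<open>1 - P 0 = 0\<close>.\<close>
      have "AE \<omega> in M. 1 - 0 ^ X \<omega> = (0::real)"
        using integrable_pgf[OF X, of 0] P0
        by (subst integral_nonneg_eq_0_iff_AE[symmetric])
          (auto simp: pgf_def prob_space power_le_one)
      then have "?P s = (\<integral>\<omega>. 1 \<partial>M)"
        unfolding pgf_def using X
        by (intro integral_cong_AE) (auto simp: power_0_left split: if_splits elim!: eventually_mono)
      then show ?thesis by (simp add: prob_space)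
    qed
    \<comment> \<open>The ratio \<open>c\<close> would force an exponent above 1. As
      \<open>P = 1\<close> satisfies the equation for every ratio, \<open>1 / n\<close> is taken,
      with exponent 1.\<close>
    have "\<exists>\<alpha>. DSS (real n) (1 / real n) \<alpha> ?P"
      by (rule DSS_pgfI[OF X]) (use n in \<open>auto simp: P1 field_simps\<close>)
    then show ?thesis by blast
  qed
qed

lemma decomposable_if_DSS:
  assumes X: "X \<in> measurable M (count_space UNIV)" and DSS: "DSS (real n) b \<alpha> (pgf M X)"
    and s: "s \<in> {0..1}"
  shows "pgf M X s = pgf M X (1 - b + b * s) ^ n"
proof -
  obtain \<psi> where \<psi>: "\<And>s. s \<in> {0..1} \<Longrightarrow> pgf M X s = exp (- \<psi> (1 - s))"
    "\<And>s. 0 < s \<Longrightarrow> s < 1 \<Longrightarrow> \<psi> (1 - s) = real n * \<psi> (b * (1 - s))"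
    and b: "0 < b" "b < 1"
    using DSS unfolding DSS_def by auto
  have "pgf M X (1 - t) = pgf M X (1 - b * t) ^ n" if "0 < t" "t < 1" for t
  proof -
    have "1 - b * t \<in> {0..1}"
      using b that by (auto intro: mult_le_one)
    then have "pgf M X (1 - b * t) = exp (- \<psi> (b * t))"
      using \<psi>(1)[of "1 - b * t"] by simp
    moreover have "pgf M X (1 - t) = exp (real n * - \<psi> (b * t))"
      using \<psi>(1)[of "1 - t"] \<psi>(2)[of "1 - t"] that by simp
    ultimately show ?thesis
      by (simp only: exp_of_nat_mult)
  qed
  moreover have "continuous_on {0..1} (\<lambda>t. pgf M X (1 - t))"
    using continuous_on_pgf_affine[OF X, of 1] by simp
  moreover have "continuous_on {0..1} (\<lambda>t. pgf M X (1 - b * t) ^ n)"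
    using b by (intro continuous_on_power continuous_on_pgf_affine X) auto
  \<comment> \<open>DSS gives the equation for \<open>\<psi>\<close> only on the open interval;
    continuity adds the endpoints.\<close>
  ultimately have "pgf M X (1 - (1 - s)) = pgf M X (1 - b * (1 - s)) ^ n"
    using s by (intro eq_on_closed_unit_interval[where s = "1 - s" and
          f = "\<lambda>t. pgf M X (1 - t)" and g = "\<lambda>t. pgf M X (1 - b * t) ^ n"]) auto
  then show ?thesis by (simp add: algebra_simps)
qed

end

section \<open>Sums of i.i.d. variables\<close>

lemma pgf_iid_sum:
  assumes "prob_space N" and iid: "iid N n Y" and "j < n" and s: "s \<in> {0..1}"
  shows "pgf N (\<lambda>\<omega>. \<Sum>i<n. Y i \<omega>) s = pgf N (Y j) s ^ n"
proof -
  interpret N: prob_space N by fact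
  have indep: "N.indep_vars (\<lambda>_. count_space UNIV) Y {..<n}"
    using iid by (simp add: iid_def)
  have eq: "pgf N (Y i) s = pgf N (Y j) s" if "i < n" for i
  proof -
    have "Y i \<in> measurable N (count_space UNIV)" "Y j \<in> measurable N (count_space UNIV)"
      using indep that \<open>j < n\<close> by (auto simp: N.indep_vars_def)
    moreover have "distr N (count_space UNIV) (Y i) = distr N (count_space UNIV) (Y j)"
      using iid that \<open>j < n\<close> unfolding iid_def by blast
    ultimately show ?thesis by (metis N.pgf_distr)
  qed
  show ?thesis
    using eq by (simp add: N.pgf_sum_indep[OF _ indep s])
qed

text \<open>Coordinates of a finite product realise \<open>n\<close> independent copies of
  \<open>q\<close> on the sample type \<open>nat \<Rightarrow> nat\<close>; \<open>d\<close> is the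
  value at indices outside \<open>{..<n}\<close>.\<close>

lemma iid_Pi_pmf:
  "iid (measure_pmf (Pi_pmf {..<n} d (\<lambda>_. q))) n (\<lambda>i \<omega>. \<omega> i)"
  unfolding iid_def
  by (auto simp: indep_vars_Pi_pmf Pi_pmf_component simp flip: map_pmf_rep_eq)

theorem theorem4p2:
  fixes n :: nat and M :: "'a measure" and X :: "'a \<Rightarrow> nat"
  assumes "n \<ge> 2"
    and "prob_space M"
    and "X \<in> measurable M (count_space UNIV)"
  shows "iid_sum_same_D_type n M X \<longleftrightarrow> (\<exists>b \<alpha>. DSS (real n) b \<alpha> (pgf M X))"
proof
  interpret prob_space M by fact
  note X = assms(3)
  assume "iid_sum_same_D_type n M X"
  then obtain N :: "(nat \<Rightarrow> nat) measure" and Y where N: "prob_space N" and iid: "iid N n Y"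
    and type: "same_D_type (pgf N (Y 0)) (pgf M X)"
    and distr: "distr M (count_space UNIV) X = distr N (count_space UNIV) (\<lambda>\<omega>. \<Sum>i<n. Y i \<omega>)"
    using assms(1) unfolding iid_sum_same_D_type_def by fastforce
  interpret N: prob_space N by fact
  obtain c where c: "0 < c" "c < 1"
    and Y0: "\<And>s. 0 < s \<Longrightarrow> s < 1 \<Longrightarrow> pgf N (Y 0) (1 - s) = pgf M X (1 - c * s)"
    using type unfolding same_D_type_def by blast
  have Y [measurable]: "Y i \<in> measurable N (count_space UNIV)" if "i < n" for i
    using iid that by (simp add: iid_def N.indep_vars_def)
  have sum: "(\<lambda>\<omega>. \<Sum>i<n. Y i \<omega>) \<in> measurable N (count_space UNIV)"
    by measurable
  \<comment> \<open>The D-type relation is extended to the endpoints, since \<open>s = 1\<close> is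
    needed for the positivity of \<open>P 0\<close>.\<close>
  have "pgf N (Y 0) (1 - s) = pgf M X (1 - c * s)" if "s \<in> {0..1}" for s
  proof (rule eq_on_closed_unit_interval[OF _ _ Y0 that])
    show "continuous_on {0..1} (\<lambda>s. pgf N (Y 0) (1 - s))"
      using N.continuous_on_pgf_affine[OF Y, of 0 1] assms(1) by simp
    show "continuous_on {0..1} (\<lambda>s. pgf M X (1 - c * s))"
      using c by (intro continuous_on_pgf_affine[OF X]) auto
  qed
  moreover have "pgf M X (1 - s) = pgf N (Y 0) (1 - s) ^ n" if "s \<in> {0..1}" for s
    using pgf_iid_sum[OF N iid, of 0 "1 - s"] assms(1) that
      pgf_distr[OF X] N.pgf_distr[OF sum] distr by auto
  ultimately show "\<exists>b \<alpha>. DSS (real n) b \<alpha> (pgf M X)"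
    using DSS_if_decomposable[OF X assms(1) c] by simp
next
  interpret prob_space M by fact
  note X = assms(3)
  assume "\<exists>b \<alpha>. DSS (real n) b \<alpha> (pgf M X)"
  then obtain b \<alpha> where DSS: "DSS (real n) b \<alpha> (pgf M X)" by blast
  then have b: "0 < b" "b < 1" by (auto simp: DSS_def)
  obtain p where p: "distr M (count_space UNIV) X = measure_pmf p"
    using distr_eq_measure_pmf[OF X] by blast
  \<comment> \<open>The law of one summand: \<open>X\<close> thinned with retention probability
    \<open>b\<close>.\<close>
  define q where "q = bind_pmf p (\<lambda>k. binomial_pmf k b)"
  define N where "N = measure_pmf (Pi_pmf {..<n} (0::nat) (\<lambda>_. q))"
  have N: "prob_space N"
    by (simp add: N_def measure_pmf.prob_space_axioms)
  have iid: "iid N n (\<lambda>i \<omega>. \<omega> i)"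
    by (simp add: N_def iid_Pi_pmf)
  have pgf_q: "pgf N (\<lambda>\<omega>. \<omega> i) s = pgf M X (1 - b + b * s)" if "i < n" "s \<in> {0..1}" for i s
  proof -
    have "pgf N (\<lambda>\<omega>. \<omega> i) s = pgf (map_pmf (\<lambda>\<omega>. \<omega> i) (Pi_pmf {..<n} (0::nat) (\<lambda>_. q))) (\<lambda>k. k) s"
      by (simp add: pgf_def N_def)
    also have "\<dots> = pgf (measure_pmf q) (\<lambda>k. k) s"
      using that by (simp add: Pi_pmf_component)
    also have "\<dots> = pgf M X (1 - b + b * s)"
      using that b pgf_distr[OF X] by (simp add: q_def pgf_thinning p)
    finally show ?thesis .
  qed
  have "same_D_type (pgf N (\<lambda>\<omega>. \<omega> i)) (pgf M X)" if "i < n" for i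
    unfolding same_D_type_def using b that
    by (intro exI[of _ b]) (auto simp: pgf_q algebra_simps)
  moreover have "distr M (count_space UNIV) X = distr N (count_space UNIV) (\<lambda>\<omega>. \<Sum>i<n. \<omega> i)"
  proof (rule distr_eq_if_pgf_eq[OF assms(2) X N])
    show "(\<lambda>\<omega>. \<Sum>i<n. \<omega> i) \<in> measurable N (count_space UNIV)"
      by (simp add: N_def)
    show "pgf M X s = pgf N (\<lambda>\<omega>. \<Sum>i<n. \<omega> i) s" if "s \<in> {0..1}" for s
      using pgf_iid_sum[OF N iid, of 0 s] decomposable_if_DSS[OF X DSS that] pgf_q[of 0 s]
        assms(1) that by simp
  qed
  ultimately show "iid_sum_same_D_type n M X"
    unfolding iid_sum_same_D_type_def using N iid by blast
qed

end
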